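(* Let $n\geq 5$ be an integer and let $G$ be an edge-colored complete $3$-uniform hypergraph $K^{(3)}_n$ that contains no rainbow copy of the tight path $\mathcal{T}$, and suppose $|C(G)|\geq 3$. Write $k=|C(G)|$. Then, after renumbering the colors as $1,2,\ldots,k$ if necessary, the vertex set $V(G)$ can be partitioned into $k-1$ parts $V_2, V_3, \ldots, V_k$ such that $\{i\}\subseteq C(V_i)\subseteq \{1,i\}$ for every $i\in\{2,3,\ldots,k\}$, and every edge not contained in a single part $V_i$ has color $1$.
   Context: An edge-coloring of a hypergraph $G$ is any map $c:E(G)\to \mathbb{N}$ (not necessarily proper). $C(G)=\{c(e): e\in E(G)\}$ is the set of colors used. For $U\subseteq V(G)$, $C(U)=\{c(e): e\in E(G),\ e\subseteq U\}$. A copy of a hypergraph $H$ in $G$ is a subhypergraph isomorphic to $H$; it is rainbow if all its edges have distinct colors. $K^{(3)}_n$ is the 3-uniform hypergraph on $n$ vertices whose edges are all 3-element subsets. The tight path $\mathcal{T}$ is the 3-graph with vertices $v_1,\ldots,v_5$ and edges $\{v_1v_2v_3, v_2v_3v_4, v_3v_4v_5\}$. *)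

theory Defs
  imports Main "HOL-Library.Disjoint_Sets"
begin

record 'a hypergraph =
  verts :: "'a set"
  edges :: "'a set set"

definition is_hypergraph :: "'a hypergraph \<Rightarrow> bool" where
  "is_hypergraph G \<longleftrightarrow> (\<forall>e\<in>edges G. e \<subseteq> verts G)"

definition subhypergraph :: "'a hypergraph \<Rightarrow> 'a hypergraph \<Rightarrow> bool" where
  "subhypergraph F G \<longleftrightarrow> is_hypergraph F \<and> verts F \<subseteq> verts G \<and> edges F \<subseteq> edges G"

definition isomorphic :: "'a hypergraph \<Rightarrow> 'b hypergraph \<Rightarrow> bool" where
  "isomorphic G H \<longleftrightarrow>
     (\<exists>f. bij_betw f (verts G) (verts H) \<and> (\<lambda>e. f ` e) ` edges G = edges H)"

definition is_copy :: "'a hypergraph \<Rightarrow> 'b hypergraph \<Rightarrow> 'a hypergraph \<Rightarrow> bool" where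
  "is_copy F H G \<longleftrightarrow> subhypergraph F G \<and> isomorphic F H"

definition complete3 :: "'a set \<Rightarrow> 'a hypergraph" where
  "complete3 V = \<lparr>verts = V, edges = {e. e \<subseteq> V \<and> card e = 3}\<rparr>"

definition tight_path :: "nat hypergraph" where
  "tight_path = \<lparr>verts = {1, 2, 3, 4, 5}, edges = {{1, 2, 3}, {2, 3, 4}, {3, 4, 5}}\<rparr>"

text \<open>A colouring of \<open>G\<close> is a total function on sets; only its values on
  \<^term>\<open>edges G\<close> are ever used.\<close>

definition colors :: "('a set \<Rightarrow> nat) \<Rightarrow> 'a hypergraph \<Rightarrow> nat set" where
  "colors c G = c ` edges G"

definition colors_within :: "('a set \<Rightarrow> nat) \<Rightarrow> 'a hypergraph \<Rightarrow> 'a set \<Rightarrow> nat set" where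
  "colors_within c G U = {c e | e. e \<in> edges G \<and> e \<subseteq> U}"

definition rainbow :: "('a set \<Rightarrow> nat) \<Rightarrow> 'a hypergraph \<Rightarrow> bool" where
  "rainbow c F \<longleftrightarrow> inj_on c (edges F)"

definition has_rainbow_copy :: "('a set \<Rightarrow> nat) \<Rightarrow> 'a hypergraph \<Rightarrow> 'b hypergraph \<Rightarrow> bool" where
  "has_rainbow_copy c G H \<longleftrightarrow> (\<exists>F. is_copy F H G \<and> rainbow c F)"

end

theory Submission
  imports Defs
begin

text \<open>Avoiding a rainbow tight path forces the colours at any single vertex to number at most
  two: in the link of a vertex, no path, star or triangle with three edges is rainbow, and such a
  colouring of a complete graph has at most two colours. Writing \<open>C(x)\<close> for the set of colours
  at \<open>x\<close>, every three of these sets meet (in the colour of the edge they span), and sets of size at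
  most two that meet three by three have a common element. This is colour 1; the parts group
  the vertices by their second colour, if any.\<close>

section \<open>Rainbow tight paths read off from triples of vertices\<close>

lemma no_rainbow_tight_path_triples:
  assumes no: "\<not> has_rainbow_copy c (complete3 V) tight_path"
    and V: "{v1, v2, v3, v4, v5} \<subseteq> V" and dist: "distinct [v1, v2, v3, v4, v5]"
  shows "c {v1, v2, v3} = c {v2, v3, v4} \<or> c {v2, v3, v4} = c {v3, v4, v5} \<or>
         c {v1, v2, v3} = c {v3, v4, v5}"
proof (rule ccontr)
  assume neq: "\<not> ?thesis"
  define F where "F = \<lparr>verts = {v1, v2, v3, v4, v5},
    edges = {{v1, v2, v3}, {v2, v3, v4}, {v3, v4, v5}}\<rparr>"
  define f :: "'a \<Rightarrow> nat" where "f v = (if v = v1 then 1 else if v = v2 then 2 else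
    if v = v3 then 3 else if v = v4 then 4 else 5)" for v
  have f: "f v1 = 1" "f v2 = 2" "f v3 = 3" "f v4 = 4" "f v5 = 5"
    using dist by (auto simp: f_def)
  have "subhypergraph F (complete3 V)"
    using V dist by (auto simp: subhypergraph_def F_def is_hypergraph_def complete3_def)
  moreover have "bij_betw f (verts F) (verts tight_path)"
    by (auto simp: bij_betw_def inj_on_def F_def tight_path_def f)
  moreover have "(\<lambda>e. f ` e) ` edges F = edges tight_path"
    by (simp add: F_def tight_path_def f)
  moreover have "rainbow c F"
    using neq by (auto simp: rainbow_def F_def inj_on_def)
  ultimately have "is_copy F tight_path (complete3 V)"
    unfolding is_copy_def isomorphic_def by blast
  with \<open>rainbow c F\<close> show False
    using no unfolding has_rainbow_copy_def by blast
qed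

section \<open>Graphs with three edges in the link of a vertex\<close>

locale path_free_coloring =
  fixes V :: "'a set" and T :: "'a \<Rightarrow> 'a \<Rightarrow> 'a \<Rightarrow> nat"
  \<comment> \<open>With ordered arguments in place of sets, these two rules let \<open>simp\<close>
    sort the vertices of every triple; equality reasoning then suffices.\<close>
  assumes swap12: "T x y z = T y x z" and swap23: "T x y z = T x z y"
    and path_free: "\<lbrakk>{a, b, c, d, e} \<subseteq> V; distinct [a, b, c, d, e]\<rbrakk>
      \<Longrightarrow> T a b c = T b c d \<or> T b c d = T c d e \<or> T a b c = T c d e"
    and finite_V: "finite V" and card_V: "card V \<ge> 5"
begin

text \<open>In the tight path \<open>a b x c d\<close> all three edges contain the middle vertex
  \<open>x\<close>; removing it leaves the path \<open>a b c d\<close>.\<close>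

lemma link_path:
  assumes "{x, a, b, c, d} \<subseteq> V" "distinct [x, a, b, c, d]"
  shows "T x a b = T x b c \<or> T x b c = T x c d \<or> T x a b = T x c d"
  using path_free[of a b x c d] assms by (simp add: swap12 swap23) argo

lemma link_star:
  assumes "{x, a, b, c, d} \<subseteq> V" "distinct [x, a, b, c, d]"
  shows "T x a b = T x a c \<or> T x a c = T x a d \<or> T x a b = T x a d"
proof -
  \<comment> \<open>Complements within the five vertices: a tight path becomes a path with three edges in
    the complete graph, and the star at \<open>a\<close> in the link of \<open>x\<close> becomes the triangle \<open>b c d\<close>.\<close>
  have K: "T r s t = T s t p \<or> T s t p = T t p q \<or> T r s t = T t p q"
    if "distinct [p, q, r, s, t]" "{p, q, r, s, t} \<subseteq> V" for p q r s t
    using path_free[of r s t p q] that by auto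
  \<comment> \<open>If the triangle \<open>b c d\<close> were rainbow, every edge from
    \<open>x\<close> or \<open>a\<close> to it would need the colour of the opposite triangle edge.
    Then the path \<open>a b c x\<close> would be rainbow.\<close>
  show ?thesis
    using K[of x b c d a] K[of x b d c a] K[of x c b d a] K[of x c d b a]
      K[of a b c d x] K[of a b d c x] K[of a b c x d]
      assms by (simp add: swap12 swap23) argo
qed

lemma link_triangle:
  assumes "{x, a, b, c} \<subseteq> V" "distinct [x, a, b, c]"
  shows "T x a b = T x b c \<or> T x b c = T x a c \<or> T x a b = T x a c"
proof -
  \<comment> \<open>A tight path has five vertices, so a fifth one is taken from
    \<open>V\<close>.\<close>
  have "card {x, a, b, c} < card V"
    using assms card_V by simp
  then obtain d where d: "d \<in> V" "d \<notin> {x, a, b, c}"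
    using assms(1) finite_V by (metis card_mono finite.emptyI finite_insert leD subsetI)
  have K: "T r s t = T s t p \<or> T s t p = T t p q \<or> T r s t = T t p q"
    if "distinct [p, q, r, s, t]" "{p, q, r, s, t} \<subseteq> V" for p q r s t
    using path_free[of r s t p q] that by auto
  \<comment> \<open>In complements this is the star with centre \<open>d\<close> and leaves \<open>a\<close>, \<open>b\<close>, \<open>c\<close>.\<close>
  show ?thesis
    using K[of c d a b x] K[of c d b a x] K[of b d a c x] K[of b d c a x]
      K[of a d b c x] K[of a d c b x]
      K[of x a d b c] K[of x a d c b] K[of x a b d c]
      assms d by (simp add: swap12 swap23) argo
qed

text \<open>Suppose three distinct colours. If \<open>u w\<close> avoids \<open>a\<close>,
  \<open>b\<close>, \<open>c\<close>, the two paths through \<open>a u\<close> force on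
  \<open>a u\<close> the colour of \<open>u w\<close>, which contradicts the star at
  \<open>a\<close>. Otherwise \<open>u w\<close> repeats an edge or completes a triangle, star or
  path.\<close>

lemma link_adjacent:
  assumes "{x, a, b, c, u, w} \<subseteq> V" "distinct [x, a, b, c]" "x \<noteq> u" "x \<noteq> w" "u \<noteq> w"
  shows "T x a b = T x a c \<or> T x a b = T x u w \<or> T x a c = T x u w"
proof -
  consider "distinct [a, b, c, u, w]" | "u \<in> {a, b, c} \<or> w \<in> {a, b, c}"
    using assms by auto
  then show ?thesis
  proof cases
    case 1
    then show ?thesis
      using link_path[of x b a u w] link_path[of x c a u w] link_star[of x a b c u]
        assms by (simp add: swap12 swap23) argo
  next
    case 2
    \<comment> \<open>Here \<open>s t\<close> is \<open>u w\<close> oriented so that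
      \<open>s\<close> is a shared vertex.\<close>
    have meet: ?thesis if uw: "T x u w = T x s t" "{s, t} \<subseteq> V" "s \<noteq> t" "x \<noteq> t" "s \<in> {a, b, c}" for s t
    proof (cases "t \<in> {a, b, c}")
      case True
      then show ?thesis
        using uw link_triangle[of x a b c] assms swap23 by (auto; metis)
    next
      case False
      then show ?thesis
        using uw assms link_star[of x a b c t] link_path[of x c a b t] link_path[of x b a c t]
          swap23 by (auto; metis)
    qed
    show ?thesis
      using 2 meet[of u w] meet[of w u] assms swap23 by (auto; metis)
  qed
qed

lemma link_two_colors:
  assumes "{x, a, b, c, d, u, w} \<subseteq> V" "x \<notin> {a, b, c, d, u, w}" "a \<noteq> b" "c \<noteq> d" "u \<noteq> w"
  shows "T x a b = T x c d \<or> T x a b = T x u w \<or> T x c d = T x u w"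
proof (cases "distinct [a, b, c, d]")
  case True
  \<comment> \<open>The link edge \<open>a c\<close> shares its colour with \<open>a b\<close> or \<open>c d\<close>, and meets the other one.\<close>
  show ?thesis
    using True link_path[of x b a c d] link_adjacent[of x a b c u w] link_adjacent[of x c a d u w]
      assms by (simp add: swap12 swap23) argo
next
  case False
  \<comment> \<open>The case \<open>t = r\<close> is included because \<open>a b\<close> and
    \<open>c d\<close> may be the same edge.\<close>
  have meet: "T x s t = T x s r \<or> T x s t = T x u w \<or> T x s r = T x u w"
    if "{s, t, r} \<subseteq> {a, b, c, d}" "s \<noteq> t" "s \<noteq> r" for s t r
    using that assms link_adjacent[of x s t r u w] by (cases "t = r") auto
  consider "a = c" | "a = d" | "b = c" | "b = d"
    using False assms by auto
  then show ?thesis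
  proof cases
    case 1
    then show ?thesis
      using meet[of a b d] assms by auto
  next
    case 2
    then show ?thesis
      using meet[of a b c] assms swap23[of x c d] by auto
  next
    case 3
    then show ?thesis
      using meet[of b a d] assms swap23[of x a b] by auto
  next
    case 4
    then show ?thesis
      using meet[of b a c] assms swap23[of x a b] swap23[of x c d] by auto
  qed
qed

end

section \<open>Colours at a vertex and a colour common to all vertices\<close>

lemma card_3_obtain_containing:
  assumes "card e = 3" "x \<in> e"
  obtains y z where "e = {x, y, z}" "x \<noteq> y" "x \<noteq> z" "y \<noteq> z"
proof -
  have "card (e - {x}) = 2"
    using assms by simp
  then obtain y z where "e - {x} = {y, z}" "y \<noteq> z"
    by (meson card_2_iff)
  then show thesis
    using that[of y z] assms(2) by blast
qed

lemma vertex_two_colors: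
  assumes "finite V" "card V \<ge> 5" "\<not> has_rainbow_copy c (complete3 V) tight_path"
    and "e \<in> edges (complete3 V)" "f \<in> edges (complete3 V)" "g \<in> edges (complete3 V)"
    and "x \<in> e" "x \<in> f" "x \<in> g"
  shows "c e = c f \<or> c e = c g \<or> c f = c g"
proof -
  interpret path_free_coloring V "\<lambda>x y z. c {x, y, z}"
  proof
    show "c {x, y, z} = c {y, x, z}" for x y z
      by (simp add: insert_commute)
    show "c {x, y, z} = c {x, z, y}" for x y z
      by (simp add: insert_commute)
    show "c {v, w, x} = c {w, x, y} \<or> c {w, x, y} = c {x, y, z} \<or> c {v, w, x} = c {x, y, z}"
      if "{v, w, x, y, z} \<subseteq> V" "distinct [v, w, x, y, z]" for v w x y z
      using assms(3) that by (rule no_rainbow_tight_path_triples)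
  qed (fact assms(1,2))+
  obtain a b where e: "e = {x, a, b}" "x \<noteq> a" "x \<noteq> b" "a \<noteq> b"
    using assms card_3_obtain_containing[of e x] by (auto simp: complete3_def)
  obtain a' b' where f: "f = {x, a', b'}" "x \<noteq> a'" "x \<noteq> b'" "a' \<noteq> b'"
    using assms card_3_obtain_containing[of f x] by (auto simp: complete3_def)
  obtain u w where g: "g = {x, u, w}" "x \<noteq> u" "x \<noteq> w" "u \<noteq> w"
    using assms card_3_obtain_containing[of g x] by (auto simp: complete3_def)
  show ?thesis
    using link_two_colors[of x a b a' b' u w] assms(4-6) e f g by (simp add: complete3_def)
qed

text \<open>If \<open>C y\<close> misses some \<open>p\<close> in \<open>C x\<close>, then
  \<open>C x\<close> and \<open>C y\<close> share only the other element \<open>q\<close> of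
  \<open>C x\<close>, and the triple intersection with any \<open>C z\<close> must be that
  \<open>q\<close>.\<close>

lemma small_sets_common_element:
  fixes C :: "'a \<Rightarrow> 'b set"
  assumes small: "\<And>x p q r. \<lbrakk>x \<in> V; p \<in> C x; q \<in> C x; r \<in> C x\<rbrakk> \<Longrightarrow> p = q \<or> p = r \<or> q = r"
    and meet: "\<And>x y z. \<lbrakk>x \<in> V; y \<in> V; z \<in> V\<rbrakk> \<Longrightarrow> C x \<inter> C y \<inter> C z \<noteq> {}"
    and "V \<noteq> {}"
  shows "\<exists>m. \<forall>x\<in>V. m \<in> C x"
proof -
  obtain x p where x: "x \<in> V" "p \<in> C x"
    using assms(3) meet by blast
  show ?thesis
  proof (cases "\<forall>y\<in>V. p \<in> C y")
    case True
    then show ?thesis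
      by blast
  next
    case False
    then obtain y where y: "y \<in> V" "p \<notin> C y"
      by blast
    then obtain q where q: "q \<in> C x" "q \<in> C y"
      using meet[OF x(1) y(1) y(1)] by blast
    have "q \<in> C z" if z: "z \<in> V" for z
    proof -
      obtain r where r: "r \<in> C x" "r \<in> C y" "r \<in> C z"
        using meet[OF x(1) y(1) z] by blast
      then have "r = q"
        using small[OF x(1) x(2) q(1) r(1)] y q by auto
      then show ?thesis
        using r by simp
    qed
    then show ?thesis
      by blast
  qed
qed

text \<open>The vertices may coincide, as they do when intersections are taken with repetition, so
  their set is enlarged to size three.\<close>

lemma obtain_edge_containing:
  assumes "finite V" "card V \<ge> 3" "x \<in> V" "y \<in> V" "z \<in> V"
  obtains e where "e \<in> edges (complete3 V)" "x \<in> e" "y \<in> e" "z \<in> e"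
proof -
  have "card {x, y, z} \<le> 3"
    by (simp add: card_insert_if)
  then obtain e where "{x, y, z} \<subseteq> e" "e \<subseteq> V" "card e = 3"
    using exists_subset_between[of "{x, y, z}" 3 V] assms by auto
  then show thesis
    using that by (auto simp: complete3_def)
qed

section \<open>The partition by second colours\<close>

theorem theorem1p3:
  fixes n k :: nat and V :: "'a set" and G :: "'a hypergraph" and c :: "'a set \<Rightarrow> nat"
  assumes "n \<ge> 5"
    and "finite V" and "card V = n"
    and "G = complete3 V"
    and "\<not> has_rainbow_copy c G tight_path"
    and "k = card (colors c G)" and "k \<ge> 3"
  shows "\<exists>(\<sigma> :: nat \<Rightarrow> nat) (P :: nat \<Rightarrow> 'a set).
           bij_betw \<sigma> (colors c G) {1..k} \<and>
           (\<Union>i\<in>{2..k}. P i) = verts G \<and>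
           disjoint_family_on P {2..k} \<and>
           (\<forall>i\<in>{2..k}. P i \<noteq> {}) \<and>
           (\<forall>i\<in>{2..k}. {i} \<subseteq> colors_within (\<sigma> \<circ> c) G (P i) \<and>
                        colors_within (\<sigma> \<circ> c) G (P i) \<subseteq> {1, i}) \<and>
           (\<forall>e\<in>edges G. (\<forall>i\<in>{2..k}. \<not> e \<subseteq> P i) \<longrightarrow> (\<sigma> \<circ> c) e = 1)"
proof -
  define C where "C x = {c e | e. e \<in> edges G \<and> x \<in> e}" for x
  have C_memI: "c e \<in> C x" if "e \<in> edges G" "x \<in> e" for e x
    using that by (auto simp: C_def)
  have C_small: "p = q \<or> p = r \<or> q = r" if pqr: "p \<in> C x" "q \<in> C x" "r \<in> C x" for p q r x
  proof -
    obtain e where e: "e \<in> edges G" "x \<in> e" "p = c e"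
      using pqr(1) by (auto simp: C_def)
    obtain f where f: "f \<in> edges G" "x \<in> f" "q = c f"
      using pqr(2) by (auto simp: C_def)
    obtain g where g: "g \<in> edges G" "x \<in> g" "r = c g"
      using pqr(3) by (auto simp: C_def)
    show ?thesis
      using vertex_two_colors[of V c e f g x] assms(1-5) e f g by simp
  qed
  have C_meet: "C x \<inter> C y \<inter> C z \<noteq> {}" if xyz: "x \<in> V" "y \<in> V" "z \<in> V" for x y z
  proof -
    have "card V \<ge> 3"
      using assms(1,3) by simp
    then obtain e where "e \<in> edges G" "x \<in> e" "y \<in> e" "z \<in> e"
      using obtain_edge_containing[OF assms(2) _ xyz] assms(4) by blast
    then show ?thesis
      using C_memI by blast
  qed
  have "V \<noteq> {}"
    using assms(1,3) by auto
  have "\<exists>m. \<forall>x\<in>V. m \<in> C x"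
  proof (rule small_sets_common_element)
    show "p = q \<or> p = r \<or> q = r" if "p \<in> C x" "q \<in> C x" "r \<in> C x" for x p q r
      using that by (rule C_small)
    show "C x \<inter> C y \<inter> C z \<noteq> {}" if "x \<in> V" "y \<in> V" "z \<in> V" for x y z
      using that by (rule C_meet)
    show "V \<noteq> {}"
      by fact
  qed
  then obtain m where m: "\<And>x. x \<in> V \<Longrightarrow> m \<in> C x"
    by blast
  have m_col: "m \<in> colors c G"
    using m \<open>V \<noteq> {}\<close> by (fastforce simp: C_def colors_def)
  have fin: "finite (colors c G)"
    using assms(2) by (simp add: colors_def assms(4) complete3_def)
  \<comment> \<open>The common colour \<open>m\<close> becomes 1; any numbering of the others by
    \<open>{2..k}\<close> will do.\<close>
  have "card (colors c G - {m}) = card {2..k}"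
    using fin m_col assms(6) by simp
  then obtain \<tau> where \<tau>: "bij_betw \<tau> (colors c G - {m}) {2..k}"
    using fin finite_same_card_bij by (metis finite_Diff finite_atLeastAtMost)
  define \<sigma> where "\<sigma> = \<tau>(m := 1)"
  have \<sigma>_m: "\<sigma> m = 1"
    by (simp add: \<sigma>_def)
  have \<sigma>': "bij_betw \<sigma> (colors c G - {m}) {2..k}"
    using \<tau> by (subst bij_betw_cong[of _ _ \<tau>]) (auto simp: \<sigma>_def)
  have "{1..k} = insert 1 {2..k}"
    using assms(7) by auto
  then have \<sigma>: "bij_betw \<sigma> (colors c G) {1..k}"
    using notIn_Un_bij_betw[OF _ _ \<sigma>', of m] m_col \<sigma>_m by (simp add: insert_absorb)
  \<comment> \<open>\<open>h x\<close> is the index of the part of \<open>x\<close>. A vertex seeing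
    only \<open>m\<close> may join any part; the default 2 is a valid index since
    \<open>k \<ge> 3\<close>.\<close>
  define h where "h x = (if C x \<subseteq> {m} then 2 else \<sigma> (SOME q. q \<in> C x \<and> q \<noteq> m))" for x
  define P where "P i = {x \<in> V. h x = i}" for i
  have edge: "e \<subseteq> V" if "e \<in> edges G" for e
    using that by (simp add: assms(4) complete3_def)
  \<comment> \<open>At most two colours occur at \<open>x\<close>, so \<open>c e\<close> is the only
    candidate for \<open>SOME\<close>. All vertices of \<open>e\<close> thus get the same
    index.\<close>
  have h_edge: "h x = \<sigma> (c e)" if "e \<in> edges G" "x \<in> e" "c e \<noteq> m" for e x
  proof -
    have "(SOME q. q \<in> C x \<and> q \<noteq> m) = c e"
      using that C_memI[of e x] C_small[of m x "c e"] m[of x] edge[of e]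
      by (intro some_equality) blast+
    then show ?thesis
      using that C_memI[of e x] by (auto simp: h_def)
  qed
  have h_range: "h x \<in> {2..k}" for x
  proof (cases "C x \<subseteq> {m}")
    case True
    then show ?thesis
      using assms(7) by (simp add: h_def)
  next
    case False
    then obtain e where "e \<in> edges G" "x \<in> e" "c e \<noteq> m"
      by (auto simp: C_def)
    then show ?thesis
      using h_edge[of e x] bij_betwE[OF \<sigma>'] by (auto simp: colors_def)
  qed
  have sub: "e \<subseteq> P (\<sigma> (c e))" "\<sigma> (c e) \<in> {2..k}" if e: "e \<in> edges G" "c e \<noteq> m" for e
  proof -
    show "e \<subseteq> P (\<sigma> (c e))"
      using h_edge[OF e(1) _ e(2)] edge[OF e(1)] by (auto simp: P_def)
    have "c e \<in> colors c G - {m}"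
      using e by (simp add: colors_def)
    then show "\<sigma> (c e) \<in> {2..k}"
      using bij_betwE[OF \<sigma>'] by blast
  qed
  have edge_ne: "e \<noteq> {}" if "e \<in> edges G" for e
    using that assms(4) by (force simp: complete3_def)
  have witness: "\<exists>e\<in>edges G. e \<subseteq> P i \<and> \<sigma> (c e) = i" if "i \<in> {2..k}" for i
  proof -
    have "i \<in> \<sigma> ` (colors c G - {m})"
      using that bij_betw_imp_surj_on[OF \<sigma>'] by simp
    then obtain e where "e \<in> edges G" "c e \<noteq> m" "\<sigma> (c e) = i"
      by (auto simp: colors_def)
    then show ?thesis
      using sub(1) by blast
  qed
  have upper: "\<sigma> (c e) \<in> {1, i}" if e: "e \<in> edges G" "e \<subseteq> P i" for e i
  proof (cases "c e = m")
    case False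
    then obtain x where "x \<in> e"
      using edge_ne[OF e(1)] by blast
    then show ?thesis
      using h_edge[OF e(1) _ False] e(2) by (auto simp: P_def)
  qed (simp add: \<sigma>_m)
  show ?thesis
  proof (intro exI conjI ballI impI)
    show "bij_betw \<sigma> (colors c G) {1..k}"
      by (fact \<sigma>)
    show "(\<Union>i\<in>{2..k}. P i) = verts G"
      using h_range by (auto simp: P_def assms(4) complete3_def)
    show "disjoint_family_on P {2..k}"
      by (auto simp: disjoint_family_on_def P_def)
    fix i assume i: "i \<in> {2..k}"
    show "P i \<noteq> {}"
      using witness[OF i] edge_ne by auto
    show "{i} \<subseteq> colors_within (\<sigma> \<circ> c) G (P i)"
      using witness[OF i] by (auto simp: colors_within_def)
    show "colors_within (\<sigma> \<circ> c) G (P i) \<subseteq> {1, i}"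
      using upper by (fastforce simp: colors_within_def)
  next
    fix e assume "e \<in> edges G" "\<forall>i\<in>{2..k}. \<not> e \<subseteq> P i"
    then have "c e = m"
      using sub by blast
    then show "(\<sigma> \<circ> c) e = 1"
      by (simp add: \<sigma>_m)
  qed
qed

end
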